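(* For any real $\nu>0$, there exists $C_\nu>0$ such that, for all large enough positive integers $k$, there is a graph $G$ with at least $C_\nu k\ln k/\ln\ln k$ vertices satisfying the following: if $H$ is any induced subgraph of $G$ or $\overline{G}$ on $\ell\ge k$ vertices, then $H$ has minimum degree less than $\left(\frac12-\ell^{-\nu}\right)(\ell-1)$.
   Context: Graphs are finite and simple. $\overline{G}$ denotes the complement of the graph $G$. $\ln$ is the natural logarithm. *)

theory Defs
  imports Complex_Main "Graph_Theory.Pair_Digraph" "Graph_Theory.Digraph_Component"
begin

text \<open>
  A finite simple graph is a \<^locale>\<open>pair_graph\<close>: each edge is represented by its two
  opposite arcs, so the degree of a vertex is its \<^const>\<open>out_degree\<close>.
\<close>

definition complement_graph :: "'a pair_pre_digraph \<Rightarrow> 'a pair_pre_digraph" where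
  "complement_graph G =
     \<lparr> pverts = pverts G,
       parcs = {(u, v). u \<in> pverts G \<and> v \<in> pverts G \<and> u \<noteq> v \<and> (u, v) \<notin> parcs G} \<rparr>"

text \<open>Only meaningful for finite graphs with at least one vertex.\<close>

definition min_degree :: "('a, 'b) pre_digraph \<Rightarrow> nat" where
  "min_degree H = Min (out_degree H ` verts H)"

lemma pair_graph_complement_graph:
  assumes "pair_graph G"
  shows "pair_graph (complement_graph G)"
proof -
  interpret pair_graph G by fact
  have "finite (pverts G \<times> pverts G)"
    by (simp add: pair_finite_verts)
  then have "finite (parcs (complement_graph G))"
    by (rule finite_subset[rotated]) (auto simp: complement_graph_def)
  then show ?thesis
    using arcs_symmetric
    by unfold_locales
      (auto simp: complement_graph_def symmetric_def sym_def pair_finite_verts)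
qed

end

theory Submission
  imports Defs "HOL-Probability.Hoeffding" "HOL-Probability.Product_PMF" "HOL-Real_Asymp.Real_Asymp"
begin

text \<open>
  The graph is random, but with edge densities that deviate from \<open>1/2\<close> on \<open>m\<close> different scales, where
  \<open>m\<close> is of order \<open>ln k\<close>. Its vertex set consists of \<open>m\<close> parts of size \<open>s = k div 3\<close>, so it has order
  \<open>k ln k\<close>, which is at least the required number of vertices. The density between parts \<open>i \<noteq> j\<close> is
  \<open>1/2 + a\<^sub>l\<close> with \<open>l = max i j\<close>, and the density inside part \<open>i\<close> is \<open>1/2 - a\<^sub>i\<close>, where the deviations
  \<open>a\<^sub>i = 16\<^sup>-\<^sup>(\<^sup>i\<^sup>+\<^sup>1\<^sup>)\<close> decay geometrically.

  Let \<open>T\<close> be a vertex set of size \<open>L \<ge> k\<close> that meets part \<open>j\<close> in \<open>t\<^sub>j\<close> vertices. A vertex of part \<open>i\<close>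
  expects about \<open>L/2 + d\<^sub>i\<close> neighbours in \<open>T\<close>, with the drift
  \<open>d\<^sub>i = a\<^sub>i (\<Sum>j<i. t\<^sub>j) - a\<^sub>i t\<^sub>i + (\<Sum>j>i. a\<^sub>j t\<^sub>j)\<close>. However \<open>T\<close> is chosen, both signs occur:

  \<^item> If \<open>i\<close> maximises \<open>t\<^sub>i / 4\<^sup>i\<close>, then the parts below \<open>i\<close> together contain at most \<open>t\<^sub>i / 3\<close> vertices
    of \<open>T\<close>; above \<open>i\<close> the numbers \<open>t\<^sub>j\<close> grow at most like \<open>4\<^sup>j\<close> while \<open>a\<^sub>j\<close> decays like \<open>16\<^sup>-\<^sup>j\<close>, so these
    parts contribute at most \<open>a\<^sub>i t\<^sub>i / 3\<close>. Hence \<open>d\<^sub>i \<le> - a\<^sub>i t\<^sub>i / 3\<close> (\<open>exists_negative_drift\<close>).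
  \<^item> If \<open>i\<close> is the last part with \<open>t\<^sub>i \<ge> L / (6 m)\<close>, then almost all of \<open>T\<close> lies in parts up to \<open>i\<close>, and
    part \<open>i\<close> holds at most a third of \<open>T\<close>, because parts have size at most \<open>k/3\<close>. Hence
    \<open>d\<^sub>i \<ge> a\<^sub>i L / 6\<close> (\<open>exists_positive_drift\<close>).

  In either case \<open>t\<^sub>i\<close> and \<open>\<bar>d\<^sub>i\<bar>\<close> are at least \<open>L\<close> divided by a fixed exponential in \<open>m\<close>, up to a factor
  \<open>6 m\<close>; with \<open>m\<close> a small multiple of \<open>ln k\<close> this loses only a small power of \<open>k\<close>. A random graph
  realises its densities between all pairs of vertex sets up to an error of \<open>O(n\<^sup>3\<^sup>/\<^sup>2)\<close>
  (\<open>exists_graph_with_prescribed_densities\<close>), which is negligible on average over the vertices of \<open>T\<close>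
  in part \<open>i\<close>. So some vertex of \<open>T\<close> has degree below \<open>L/2\<close> by much more than \<open>L\<^sup>1\<^sup>-\<^sup>\<nu>\<close> in the graph,
  and by the second case some vertex has such a degree in the complement.
\<close>

section \<open>Random graphs with prescribed densities\<close>

text \<open>
  Put each \<open>e\<close> into \<open>X\<close> independently with probability \<open>p e\<close>. By Hoeffding's inequality a fixed \<open>A\<close> has
  discrepancy at least \<open>t\<close> with probability at most \<open>2 exp (- 2 t\<^sup>2 / card A)\<close>, and the numerical hypothesis
  is what the union bound over \<open>F\<close> needs.
\<close>

lemma exists_set_of_small_discrepancy:
  fixes p :: "'a \<Rightarrow> real" and F :: "'a set set"
  assumes "finite E" and p: "\<And>e. e \<in> E \<Longrightarrow> p e \<in> {0..1}"
    and "finite F" and F: "\<And>A. A \<in> F \<Longrightarrow> A \<subseteq> E"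
    and "t > 0" and union: "2 * real (card F) * exp (- 2 * t\<^sup>2 / real (card E)) < 1"
  shows "\<exists>X. \<forall>A\<in>F. \<bar>\<Sum>e\<in>A. (of_bool (e \<in> X) - p e)\<bar> < t"
proof -
  define M where "M = Pi_pmf E False (\<lambda>e. bernoulli_pmf (p e))"
  define bad where "bad A = {f. \<bar>\<Sum>e\<in>A. (of_bool (f e) - p e)\<bar> \<ge> t}" for A
  have bad: "measure_pmf.prob M (bad A) \<le> 2 * exp (- 2 * t\<^sup>2 / real (card E))" if "A \<in> F" for A
  proof (cases "A = {}")
    case True
    then show ?thesis using \<open>t > 0\<close> by (simp add: bad_def)
  next
    case False
    have "A \<subseteq> E" using F that by blast
    then have "finite A" using \<open>finite E\<close> finite_subset by blast
    have E: "measure_pmf.expectation M (\<lambda>f. of_bool (f e)) = p e" if "e \<in> A" for e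
    proof -
      have "measure_pmf.expectation M (\<lambda>f. of_bool (f e)) =
            measure_pmf.expectation (map_pmf (\<lambda>f. f e) M) (of_bool :: bool \<Rightarrow> real)"
        by simp
      also have "map_pmf (\<lambda>f. f e) M = bernoulli_pmf (p e)"
        using that \<open>A \<subseteq> E\<close> \<open>finite E\<close> by (auto simp: M_def Pi_pmf_component)
      finally show ?thesis using p[of e] that \<open>A \<subseteq> E\<close> by auto
    qed
    interpret Hoeffding_ineq M A "\<lambda>e f. of_bool (f e)" "\<lambda>_. 0" "\<lambda>_. 1" "\<Sum>e\<in>A. p e"
    proof unfold_locales
      show "prob_space.indep_vars (measure_pmf M) (\<lambda>_. borel) (\<lambda>e f. of_bool (f e) :: real) A"
        unfolding M_def
        by (rule prob_space.indep_vars_subset[OF _ _ \<open>A \<subseteq> E\<close>])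
           (use \<open>finite E\<close> in \<open>auto simp: measure_pmf.prob_space_axioms
             intro!: prob_space.indep_vars_compose2[OF _ indep_vars_Pi_pmf]\<close>)
      show "(\<Sum>e\<in>A. p e) \<equiv> \<Sum>e\<in>A. measure_pmf.expectation M (\<lambda>f. of_bool (f e))"
        by (rule eq_reflection) (simp add: E)
    qed (use \<open>finite A\<close> in auto)
    have "card A > 0" "card A \<le> card E"
      using False \<open>finite A\<close> \<open>A \<subseteq> E\<close> \<open>finite E\<close> by (auto simp: card_gt_0_iff card_mono)
    have "measure_pmf.prob M (bad A) \<le> 2 * exp (- 2 * t\<^sup>2 / real (card A))"
      using Hoeffding_ineq_abs_ge[of t] \<open>t > 0\<close> \<open>card A > 0\<close> by (simp add: bad_def sum_subtractf)
    also have "\<dots> \<le> 2 * exp (- 2 * t\<^sup>2 / real (card E))"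
      using \<open>card A > 0\<close> \<open>card A \<le> card E\<close> by (simp add: frac_le)
    finally show ?thesis .
  qed
  have "measure_pmf.prob M (\<Union>A\<in>F. bad A) \<le> (\<Sum>A\<in>F. measure_pmf.prob M (bad A))"
    using \<open>finite F\<close> by (intro measure_pmf.finite_measure_subadditive_finite) auto
  also have "\<dots> \<le> (\<Sum>A\<in>F. 2 * exp (- 2 * t\<^sup>2 / real (card E)))"
    by (intro sum_mono bad)
  also have "\<dots> < 1" using union by simp
  finally have "(\<Union>A\<in>F. bad A) \<noteq> UNIV" by auto
  then obtain f where "\<And>A. A \<in> F \<Longrightarrow> f \<notin> bad A" by blast
  then show ?thesis
    by (intro exI[of _ "{e. f e}"]) (force simp: bad_def)
qed

text \<open>
  A double sum over \<open>U\<close> and \<open>T\<close> splits into the pairs \<open>u < v\<close> and the pairs \<open>v < u\<close>. Each half is a sum over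
  a set of edges, each edge counted once, and there are at most \<open>4\<^sup>n\<close> such sets; the union bound then
  allows a discrepancy of order \<open>n\<^sup>3\<^sup>/\<^sup>2\<close> for each of them.
\<close>
lemma exists_graph_with_prescribed_densities:
  fixes p :: "nat \<Rightarrow> nat \<Rightarrow> real"
  assumes "n > 0" and p: "\<And>u v. p u v \<in> {0..1}" and p_sym: "\<And>u v. p u v = p v u"
  shows "\<exists>adj. (\<forall>u v. adj u v = adj v u) \<and>
    (\<forall>U T. U \<subseteq> {..<n} \<longrightarrow> T \<subseteq> {..<n} \<longrightarrow>
      \<bar>\<Sum>u\<in>U. \<Sum>v\<in>T - {u}. (of_bool (adj u v) - p u v)\<bar> \<le> 4 * real n * sqrt (real n))"
proof -
  define E where "E = {(u, v). u < v \<and> v < n}"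
  define cut where "cut U T = {(u, v). u \<in> U \<and> v \<in> T \<and> u < v}" for U T :: "nat set"
  define F where "F = (\<lambda>(U, T). cut U T) ` (Pow {..<n} \<times> Pow {..<n})"
  have "E \<subseteq> {..<n} \<times> {..<n}" by (auto simp: E_def)
  then have "finite E" and "card E \<le> n * n"
    using finite_subset card_mono[of "{..<n} \<times> {..<n}" E] by auto
  have "finite F" by (simp add: F_def)
  have "card F \<le> card (Pow {..<n} \<times> Pow {..<n})" unfolding F_def by (rule card_image_le) simp
  also have "\<dots> = 4 ^ n" by (simp add: card_Pow flip: power_mult_distrib)
  finally have "real (card F) \<le> 4 ^ n" by (metis of_nat_le_iff of_nat_numeral of_nat_power)
  have F: "A \<subseteq> E" if "A \<in> F" for A using that by (auto simp: F_def E_def cut_def)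
  \<comment> \<open>Large enough for the failure probability \<open>2 exp (- 8 n)\<close> of a single set to beat the \<open>4\<^sup>n\<close> sets.\<close>
  define t where "t = 2 * real n * sqrt (real n)"
  have t2: "t\<^sup>2 = 4 * real n * (real n * real n)"
    by (simp add: t_def power_mult_distrib power2_eq_square)
  have "\<exists>X. \<forall>A\<in>F. \<bar>\<Sum>e\<in>A. (of_bool (e \<in> X) - case_prod p e)\<bar> < t"
  proof (cases "E = {}")
    case True
    have "t > 0" using \<open>n > 0\<close> by (simp add: t_def)
    moreover have "A = {}" if "A \<in> F" for A using F[OF that] True by simp
    ultimately show ?thesis by (metis abs_zero sum.empty)
  next
    case False
    have "card E > 0" using False \<open>finite E\<close> by auto
    have "real (card E) \<le> real n * real n"
      using \<open>card E \<le> n * n\<close> by (metis of_nat_le_iff of_nat_mult)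
    have "8 * real n = 2 * t\<^sup>2 / (real n * real n)" using \<open>n > 0\<close> by (simp add: t2)
    also have "\<dots> \<le> 2 * t\<^sup>2 / real (card E)"
      using \<open>card E > 0\<close> \<open>real (card E) \<le> _\<close> by (intro divide_left_mono) auto
    finally have "exp (- 2 * t\<^sup>2 / real (card E)) \<le> exp (- (8 * real n))" by simp
    also have "\<dots> = 1 / exp 8 ^ n"
      by (simp add: exp_minus exp_of_nat_mult mult.commute inverse_eq_divide)
    finally have "2 * real (card F) * exp (- 2 * t\<^sup>2 / real (card E)) \<le> 2 * 4 ^ n * (1 / exp 8 ^ n)"
      using \<open>real (card F) \<le> 4 ^ n\<close> by (intro mult_mono) auto
    also have "\<dots> \<le> 2 ^ n * 4 ^ n / exp 8 ^ n"
      using self_le_power[of "2::real" n] \<open>n > 0\<close> by (simp add: divide_right_mono)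
    also have "\<dots> = (8 / exp 8) ^ n" by (simp add: power_divide flip: power_mult_distrib)
    also have "\<dots> < 1"
      using exp_ge_add_one_self[of "8::real"] \<open>n > 0\<close>
      by (simp add: power_less_one_iff)
    finally show ?thesis
      using \<open>finite E\<close> \<open>finite F\<close> F \<open>n > 0\<close> p
      by (intro exists_set_of_small_discrepancy[where E = E]) (auto simp: t_def split: prod.splits)
  qed
  then obtain X where X: "\<And>A. A \<in> F \<Longrightarrow> \<bar>\<Sum>e\<in>A. (of_bool (e \<in> X) - case_prod p e)\<bar> < t"
    by blast
  define adj where "adj u v = ((min u v, max u v) \<in> X)" for u v
  have sym: "adj u v = adj v u" for u v by (simp add: adj_def min.commute max.commute)
  define d where "d u v = of_bool (adj u v) - p u v" for u v
  have d_sym: "d u v = d v u" for u v by (simp add: d_def sym[of u] p_sym[of u])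
  have cut: "\<bar>\<Sum>(u, v)\<in>cut U T. d u v\<bar> < t" if "U \<subseteq> {..<n}" "T \<subseteq> {..<n}" for U T
  proof -
    have "(\<Sum>(u, v)\<in>cut U T. d u v) = (\<Sum>e\<in>cut U T. (of_bool (e \<in> X) - case_prod p e))"
      by (intro sum.cong) (auto simp: cut_def d_def adj_def min_def max_def)
    then show ?thesis using X[of "cut U T"] that by (auto simp: F_def)
  qed
  have "\<bar>\<Sum>u\<in>U. \<Sum>v\<in>T - {u}. d u v\<bar> \<le> 4 * real n * sqrt (real n)"
    if "U \<subseteq> {..<n}" "T \<subseteq> {..<n}" for U T
  proof -
    have fin: "finite U" "finite T" using that finite_subset by blast+
    have fin_cut: "finite (cut U T)" "finite (cut T U)"
      using fin by (auto intro: finite_subset[of _ "U \<times> T"] finite_subset[of _ "T \<times> U"] simp: cut_def)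
    have split: "Sigma U (\<lambda>u. T - {u}) = cut U T \<union> prod.swap ` cut T U"
      by (auto simp: cut_def image_iff)
    have "(\<Sum>u\<in>U. \<Sum>v\<in>T - {u}. d u v) = (\<Sum>(u, v)\<in>Sigma U (\<lambda>u. T - {u}). d u v)"
      using fin by (intro sum.Sigma) auto
    also have "\<dots> = (\<Sum>(u, v)\<in>cut U T. d u v) + (\<Sum>(u, v)\<in>prod.swap ` cut T U. d u v)"
      unfolding split using fin_cut by (intro sum.union_disjoint) (auto simp: cut_def)
    also have "(\<Sum>(u, v)\<in>prod.swap ` cut T U. d u v) = (\<Sum>(u, v)\<in>cut T U. d u v)"
      by (subst sum.reindex) (auto simp: d_sym intro!: sum.cong)
    finally show ?thesis using cut[of U T] cut[of T U] that by (simp add: t_def)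
  qed
  then show ?thesis using sym unfolding d_def by blast
qed

section \<open>Hierarchical densities\<close>

text \<open>
  The deviation from \<open>1/2\<close> of the density between parts \<open>i\<close> and \<open>j\<close>. The weaker of the two scales decides,
  and the opposite sign on the diagonal makes both signs of the drift unavoidable.
\<close>
definition bias :: "nat \<Rightarrow> nat \<Rightarrow> real" where
  "bias i j = (if i = j then - 1 else 1) / 16 ^ Suc (max i j)"

lemma bias_sym: "bias i j = bias j i"
  by (simp add: bias_def max.commute)

lemma abs_bias_le: "\<bar>bias i j\<bar> \<le> 1 / 2"
proof -
  have "(2::real) \<le> 16 ^ Suc k" for k
    using one_le_power[of "16::real" k] unfolding power_Suc by linarith
  then show ?thesis by (auto simp: bias_def simp del: power_Suc)
qed

lemma sum_lessThan_split_at: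
  fixes f :: "nat \<Rightarrow> real"
  assumes "i < m"
  shows "(\<Sum>j<m. f j) = (\<Sum>j<i. f j) + f i + (\<Sum>j\<in>{i<..<m}. f j)"
proof -
  have "{..<m} = {..<i} \<union> {i..<m}" "{i..<m} = insert i {i<..<m}" using assms by auto
  moreover have "(\<Sum>j\<in>{..<i} \<union> {i..<m}. f j) = (\<Sum>j<i. f j) + (\<Sum>j\<in>{i..<m}. f j)"
    by (rule sum.union_disjoint) auto
  moreover have "(\<Sum>j\<in>insert i {i<..<m}. f j) = f i + (\<Sum>j\<in>{i<..<m}. f j)"
    by (rule sum.insert) auto
  ultimately show ?thesis by (metis add.assoc)
qed

lemma drift_split:
  assumes "i < m"
  shows "16 ^ Suc i * (\<Sum>j<m. bias i j * t j) =
    (\<Sum>j<i. t j) - t i + (\<Sum>j\<in>{i<..<m}. t j / 16 ^ (j - i))"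
proof -
  have "(\<Sum>j<m. bias i j * t j) =
      (\<Sum>j<i. bias i j * t j) + bias i i * t i + (\<Sum>j\<in>{i<..<m}. bias i j * t j)"
    using assms by (rule sum_lessThan_split_at)
  also have "(\<Sum>j<i. bias i j * t j) = (\<Sum>j<i. t j) / 16 ^ Suc i"
    by (simp add: bias_def max_def sum_divide_distrib)
  also have "(\<Sum>j\<in>{i<..<m}. bias i j * t j) = (\<Sum>j\<in>{i<..<m}. t j / 16 ^ (j - i)) / 16 ^ Suc i"
    unfolding sum_divide_distrib
    by (intro sum.cong) (auto simp: bias_def max_def simp flip: power_add)
  also have "bias i i * t i = - t i / 16 ^ Suc i" by (simp add: bias_def)
  finally have "(\<Sum>j<m. bias i j * t j) =
      ((\<Sum>j<i. t j) - t i + (\<Sum>j\<in>{i<..<m}. t j / 16 ^ (j - i))) / 16 ^ Suc i"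
    by (simp only: add_divide_distrib diff_divide_distrib)
  then show ?thesis by (simp del: power_Suc)
qed

lemma geometric_sum_below: "(\<Sum>j<i. 1 / 4 ^ (i - j)) \<le> (1 / 3 :: real)"
proof -
  have "(\<Sum>j<i. 1 / 4 ^ (i - j)) = (\<Sum>j<i. 1 / 4 ^ j) / (4::real)"
    unfolding sum_divide_distrib
    by (rule sum.reindex_bij_witness[of _ "\<lambda>j. i - Suc j" "\<lambda>j. i - Suc j"])
       (auto simp: Suc_diff_Suc simp flip: power_Suc2)
  also have "\<dots> = (1 - (1 / 4) ^ i) / 3"
    using sum_gp_strict[of "1 / 4 :: real" i] by (simp add: power_divide)
  finally show ?thesis by simp
qed

lemma geometric_sum_above: "(\<Sum>j\<in>{i<..<m}. 1 / 4 ^ (j - i)) \<le> (1 / 3 :: real)"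
proof -
  have "(\<Sum>j\<in>{i<..<m}. 1 / 4 ^ (j - i)) = (\<Sum>j<m - Suc i. 1 / 4 ^ (m - Suc i - j) :: real)"
    by (rule sum.reindex_bij_witness[of _ "\<lambda>j. m - Suc j" "\<lambda>j. m - Suc j"]) auto
  then show ?thesis using geometric_sum_below[of "m - Suc i"] by simp
qed

text \<open>
  Take \<open>i\<close> maximising \<open>t i / 4 ^ i\<close>. The base \<open>4\<close> is the geometric mean of \<open>1\<close> and \<open>16\<close>: the parts below \<open>i\<close>
  enter with the same scale as part \<open>i\<close> but have weights decaying like \<open>4 ^ (j - i)\<close>, and those above may
  have weights growing at this rate but enter with scales decaying like \<open>16 ^ (i - j)\<close>. Each side thus
  cancels at most a third of the diagonal term.
\<close>
lemma exists_negative_drift: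
  fixes t :: "nat \<Rightarrow> real"
  assumes "m > 0" and t: "\<And>j. t j \<ge> 0" and L: "(\<Sum>j<m. t j) = L"
  shows "\<exists>i<m. t i \<ge> L / (6 * real m * 4 ^ m) \<and>
    (\<Sum>j<m. bias i j * t j) \<le> - (L / (6 * real m * 64 ^ m))"
proof -
  have "L \<ge> 0" using L t by (auto intro!: sum_nonneg)
  define g where "g j = t j / 4 ^ j" for j
  obtain i where i: "i < m" and max: "\<And>j. j < m \<Longrightarrow> g j \<le> g i"
  proof -
    have "finite {..<m}" "{..<m} \<noteq> {}" using \<open>m > 0\<close> by auto
    then obtain i where "i \<in> {..<m}" "(MAX j\<in>{..<m}. g j) = g i"
      by (rule obtains_MAX)
    then show thesis using that[of i] by (metis Max_ge finite_imageI finite_lessThan imageI lessThan_iff)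
  qed
  have t_le: "t j \<le> t i * 4 ^ j / 4 ^ i" if "j < m" for j
    using max[OF that] by (simp add: g_def field_simps)
  have "L \<le> real (card {..<m}) * (4 ^ m * t i)"
    unfolding L[symmetric]
  proof (intro sum_bounded_above)
    fix j assume "j \<in> {..<m}"
    have "t j \<le> t i * 4 ^ j / 4 ^ i" using t_le \<open>j \<in> {..<m}\<close> by simp
    also have "\<dots> \<le> t i * 4 ^ j" using divide_left_mono[of 1 "4 ^ i" "t i * 4 ^ j"] t[of i] by simp
    also have "\<dots> \<le> t i * 4 ^ m" using t[of i] \<open>j \<in> {..<m}\<close> by (intro mult_left_mono) auto
    finally show "t j \<le> 4 ^ m * t i" by (simp add: mult.commute)
  qed
  then have ti: "L / (real m * 4 ^ m) \<le> t i" using \<open>m > 0\<close> by (simp add: field_simps)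
  have "(\<Sum>j<i. t j) \<le> (\<Sum>j<i. t i * (1 / 4 ^ (i - j)))"
    using t_le i by (intro sum_mono) (auto simp: power_diff field_simps)
  also have "\<dots> \<le> t i * (1 / 3)"
    unfolding sum_distrib_left[symmetric] by (intro mult_left_mono geometric_sum_below t)
  finally have below: "(\<Sum>j<i. t j) \<le> t i / 3" by simp
  have "(\<Sum>j\<in>{i<..<m}. t j / 16 ^ (j - i)) \<le> (\<Sum>j\<in>{i<..<m}. t i * (1 / 4 ^ (j - i)))"
  proof (intro sum_mono)
    fix j assume j: "j \<in> {i<..<m}"
    have "(16::real) ^ (j - i) = 4 ^ (j - i) * 4 ^ (j - i)" by (simp flip: power_mult_distrib)
    moreover have "t j \<le> t i * 4 ^ (j - i)" using t_le[of j] j by (simp add: power_diff)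
    ultimately show "t j / 16 ^ (j - i) \<le> t i * (1 / 4 ^ (j - i))" by (simp add: field_simps)
  qed
  also have "\<dots> \<le> t i * (1 / 3)"
    unfolding sum_distrib_left[symmetric] by (intro mult_left_mono geometric_sum_above t)
  finally have "16 ^ Suc i * (\<Sum>j<m. bias i j * t j) \<le> - (t i / 3)"
    using below by (simp only: drift_split[OF i])
  then have "(\<Sum>j<m. bias i j * t j) \<le> - (t i / (3 * 16 ^ Suc i))"
    by (simp add: field_simps)
  also have "\<dots> \<le> - (L / (real m * 4 ^ m) / (3 * 16 ^ m))"
    using ti t[of i] i power_increasing[of "Suc i" m "16::real"]
    by (intro le_imp_neg_le frac_le) auto
  also have "\<dots> = - (L / (3 * real m * 64 ^ m))"
    by (simp add: flip: power_mult_distrib)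
  also have "\<dots> \<le> - (L / (6 * real m * 64 ^ m))"
    using \<open>L \<ge> 0\<close> \<open>m > 0\<close> by (intro le_imp_neg_le divide_left_mono mult_right_mono) auto
  finally have drift: "(\<Sum>j<m. bias i j * t j) \<le> - (L / (6 * real m * 64 ^ m))" .
  have "L / (6 * real m * 4 ^ m) \<le> L / (real m * 4 ^ m)"
    using \<open>L \<ge> 0\<close> \<open>m > 0\<close> by (intro divide_left_mono mult_right_mono) auto
  then show ?thesis using ti i drift by force
qed

text \<open>
  Take the last \<open>i\<close> whose weight is at least \<open>L / (6 m)\<close>. All later parts together weigh at most \<open>L / 6\<close>
  and contribute with positive sign, while the parts below weigh at least \<open>L - L / 3 - L / 6 = L / 2\<close>,
  which exceeds the diagonal weight, at most \<open>L / 3\<close>, by \<open>L / 6\<close>. The bounds are then weakened to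
  those of \<open>exists_negative_drift\<close>, so that both signs can be used in the same way.
\<close>
lemma exists_positive_drift:
  fixes t :: "nat \<Rightarrow> real"
  assumes "m > 0" and t: "\<And>j. t j \<ge> 0" and L: "(\<Sum>j<m. t j) = L" "L > 0"
    and t_le: "\<And>j. t j \<le> L / 3"
  shows "\<exists>i<m. t i \<ge> L / (6 * real m * 4 ^ m) \<and>
    (\<Sum>j<m. bias i j * t j) \<ge> L / (6 * real m * 64 ^ m)"
proof -
  define S where "S = {i. i < m \<and> t i \<ge> L / (6 * real m)}"
  have "S \<noteq> {}"
  proof
    assume "S = {}"
    then have "(\<Sum>j<m. t j) \<le> (\<Sum>j<m. L / (6 * real m))"
      by (intro sum_mono) (force simp: S_def)
    also have "\<dots> = L / 6" using \<open>m > 0\<close> by simp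
    finally show False using L by simp
  qed
  define i where "i = Max S"
  have "finite S" by (simp add: S_def)
  then have "i \<in> S" and max: "\<And>j. j \<in> S \<Longrightarrow> j \<le> i"
    using \<open>S \<noteq> {}\<close> by (auto simp: i_def)
  then have i: "i < m" "t i \<ge> L / (6 * real m)" by (auto simp: S_def)
  have "(\<Sum>j\<in>{i<..<m}. t j) \<le> (\<Sum>j\<in>{i<..<m}. L / (6 * real m))"
    using max by (intro sum_mono) (force simp: S_def)
  also have "\<dots> \<le> (\<Sum>j<m. L / (6 * real m))"
    using L(2) by (intro sum_mono2) auto
  also have "\<dots> = L / 6" using \<open>m > 0\<close> by simp
  finally have above: "(\<Sum>j\<in>{i<..<m}. t j) \<le> L / 6" .
  have "L = (\<Sum>j<i. t j) + t i + (\<Sum>j\<in>{i<..<m}. t j)"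
    using sum_lessThan_split_at[OF i(1)] L(1) by simp
  then have "L / 6 \<le> (\<Sum>j<i. t j) - t i" using above t_le[of i] by linarith
  moreover have "(\<Sum>j\<in>{i<..<m}. t j / 16 ^ (j - i)) \<ge> 0"
    using t by (intro sum_nonneg) auto
  ultimately have "L / 6 \<le> 16 ^ Suc i * (\<Sum>j<m. bias i j * t j)"
    by (simp only: drift_split[OF i(1)])
  then have "L / (6 * 16 ^ Suc i) \<le> (\<Sum>j<m. bias i j * t j)"
    by (simp add: field_simps)
  moreover have "L / (6 * real m * 64 ^ m) \<le> L / (6 * 16 ^ Suc i)"
  proof -
    have "(16::real) ^ Suc i \<le> 16 ^ m" using i by (intro power_increasing) auto
    also have "\<dots> \<le> 64 ^ m" by (intro power_mono) auto
    also have "\<dots> \<le> real m * 64 ^ m" using \<open>m > 0\<close> by simp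
    finally show ?thesis using L(2) \<open>m > 0\<close> by (intro divide_left_mono) auto
  qed
  moreover have "L / (6 * real m * 4 ^ m) \<le> L / (6 * real m)"
    using L(2) \<open>m > 0\<close> by (intro divide_left_mono) auto
  ultimately show ?thesis using i by (intro exI[of _ i]) auto
qed


section \<open>The graph\<close>

lemma exists_le_average:
  fixes f :: "'a \<Rightarrow> real"
  assumes "finite U" "U \<noteq> {}" "(\<Sum>u\<in>U. f u) \<le> real (card U) * c"
  shows "\<exists>u\<in>U. f u \<le> c"
proof (rule ccontr)
  assume "\<not> ?thesis"
  then have "(\<Sum>u\<in>U. c) < (\<Sum>u\<in>U. f u)" using assms by (intro sum_strict_mono) auto
  then show False using assms by simp
qed

text \<open>
  How far some degree falls below \<open>(L - 1) / 2\<close>, for \<open>m\<close> parts, \<open>n\<close> vertices in total and a set of \<open>L\<close> of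
  them. The first term is the guaranteed drift; the second pays for the vertex not being its own
  neighbour; the third is the discrepancy \<open>4 n\<^sup>3\<^sup>/\<^sup>2\<close> averaged over the at least \<open>L / (6 m 4\<^sup>m)\<close> vertices of
  the set in the chosen part.
\<close>
definition degree_gap :: "nat \<Rightarrow> nat \<Rightarrow> real \<Rightarrow> real" where
  "degree_gap m n L =
     L / (6 * real m * 64 ^ m) - 1 - 24 * real m * 4 ^ m * real n * sqrt (real n) / L"

text \<open>
  The edge density between \<open>u\<close> and \<open>v\<close> is prescribed by their parts \<open>u div s\<close> and \<open>v div s\<close>. In a part of
  negative drift the average degree into \<open>T\<close> is below half by the gap, and in a part of positive drift
  the average number of non-neighbours is; a vertex no worse than the average exists in either case.
\<close>
lemma exists_graph_without_balanced_subgraphs: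
  fixes m s :: nat
  defines "n \<equiv> m * s"
  assumes "m > 0" "s > 0"
  obtains adj where "\<And>u v. adj u v = adj v u"
    and "\<And>T. T \<subseteq> {..<n} \<Longrightarrow> 3 * s \<le> card T \<Longrightarrow>
      \<exists>u\<in>T. real (card {v \<in> T - {u}. adj u v})
        \<le> (real (card T) - 1) / 2 - degree_gap m n (real (card T))"
    and "\<And>T. T \<subseteq> {..<n} \<Longrightarrow> 3 * s \<le> card T \<Longrightarrow>
      \<exists>u\<in>T. real (card {v \<in> T - {u}. \<not> adj u v})
        \<le> (real (card T) - 1) / 2 - degree_gap m n (real (card T))"
proof -
  define p where "p u v = 1 / 2 + bias (u div s) (v div s)" for u v
  have "n > 0" using assms by simp
  moreover have "p u v \<in> {0..1}" for u v
    using abs_bias_le[of "u div s" "v div s"] by (auto simp: p_def abs_le_iff)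
  moreover have "p u v = p v u" for u v by (simp add: p_def bias_sym)
  ultimately obtain adj where sym: "\<And>u v. adj u v = adj v u"
    and disc: "\<And>U T. U \<subseteq> {..<n} \<Longrightarrow> T \<subseteq> {..<n} \<Longrightarrow>
      \<bar>\<Sum>u\<in>U. \<Sum>v\<in>T - {u}. (of_bool (adj u v) - p u v)\<bar> \<le> 4 * real n * sqrt (real n)"
    using exists_graph_with_prescribed_densities[of n p] by blast
  have "(\<exists>u\<in>T. real (card {v \<in> T - {u}. adj u v}) \<le> (L - 1) / 2 - g) \<and>
        (\<exists>u\<in>T. real (card {v \<in> T - {u}. \<not> adj u v}) \<le> (L - 1) / 2 - g)"
    if T: "T \<subseteq> {..<n}" and card_T: "3 * s \<le> card T" and L: "L = real (card T)"
      and g: "g = degree_gap m n L" for T L g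
  proof -
    have "finite T" using T finite_subset by blast
    have "real (3 * s) \<le> L" unfolding L of_nat_le_iff by (rule card_T)
    then have sL: "real s \<le> L / 3" by simp
    then have "L > 0" using \<open>s > 0\<close> by simp
    define deg where "deg u = real (card {v \<in> T - {u}. adj u v})" for u
    have codeg: "real (card {v \<in> T - {u}. \<not> adj u v}) = L - 1 - deg u" if "u \<in> T" for u
    proof -
      have "card (T - {u}) = card {v \<in> T - {u}. adj u v} + card {v \<in> T - {u}. \<not> adj u v}"
        using \<open>finite T\<close> by (subst card_Un_disjoint[symmetric]) (auto intro: arg_cong[of _ _ card])
      moreover have "real (card (T - {u})) = L - 1"
        using that \<open>finite T\<close> \<open>L > 0\<close> L by (simp add: of_nat_diff)
      ultimately show ?thesis by (simp add: deg_def)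
    qed
    define part where "part i = {v \<in> T. v div s = i}" for i
    define t where "t i = real (card (part i))" for i
    define drift where "drift i = (\<Sum>j<m. bias i j * t j)" for i
    have T_div: "v div s < m" if "v \<in> T" for v
      using that T by (auto simp: n_def less_mult_imp_div_less)
    have part_sum: "(\<Sum>j<m. \<Sum>v\<in>part j. f v) = (\<Sum>v\<in>T. f v)" for f :: "nat \<Rightarrow> real"
      unfolding part_def using \<open>finite T\<close> T_div by (intro sum.group) auto
    have t_sum: "(\<Sum>j<m. t j) = L" using part_sum[of "\<lambda>_. 1"] by (simp add: t_def L)
    have "t i \<le> real s" for i
    proof -
      have "part i \<subseteq> {i * s..<i * s + s}"
        using dividend_less_div_times[OF \<open>s > 0\<close>] by (auto simp: part_def add.commute)
      then have "card (part i) \<le> card {i * s..<i * s + s}" by (intro card_mono) auto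
      then show ?thesis by (simp add: t_def)
    qed
    then have t_le: "t i \<le> L / 3" for i using sL order_trans by blast
    have drift: "(\<Sum>v\<in>T. bias i (v div s)) = drift i" for i
    proof -
      have "(\<Sum>v\<in>T. bias i (v div s)) = (\<Sum>j<m. \<Sum>v\<in>part j. bias i (v div s))"
        by (rule part_sum[symmetric])
      also have "\<dots> = (\<Sum>j<m. \<Sum>v\<in>part j. bias i j)"
        by (intro sum.cong) (auto simp: part_def)
      finally show ?thesis by (simp add: drift_def t_def mult.commute)
    qed
    define e where "e = 24 * real m * 4 ^ m * real n * sqrt (real n) / L"
    \<comment> \<open>The term \<open>bias i i\<close> is subtracted because \<open>drift i\<close> also counts the vertex itself.\<close>
    have deg_sum: "\<bar>(\<Sum>u\<in>part i. deg u) - t i * ((L - 1) / 2 + drift i - bias i i)\<bar> \<le> t i * e"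
      if ti: "t i \<ge> L / (6 * real m * 4 ^ m)" for i
    proof -
      have inner: "(\<Sum>v\<in>T - {u}. (of_bool (adj u v) - p u v)) =
          deg u - ((L - 1) / 2 + drift i - bias i i)" if "u \<in> part i" for u
      proof -
        have u: "u \<in> T" "u div s = i" using that by (auto simp: part_def)
        have "(\<Sum>v\<in>T - {u}. of_bool (adj u v)) = deg u"
          using \<open>finite T\<close> by (simp add: deg_def of_bool_def sum.If_cases Int_def)
        moreover have "(\<Sum>v\<in>T - {u}. p u v) = (\<Sum>v\<in>T. p u v) - p u u"
          using u \<open>finite T\<close> by (simp add: sum_diff1)
        moreover have "(\<Sum>v\<in>T. p u v) = L / 2 + drift i"
          by (simp add: p_def sum.distrib u drift L)
        ultimately show ?thesis by (simp add: sum_subtractf p_def u diff_divide_distrib)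
      qed
      have "part i \<subseteq> {..<n}" using T by (auto simp: part_def)
      then have "\<bar>\<Sum>u\<in>part i. \<Sum>v\<in>T - {u}. (of_bool (adj u v) - p u v)\<bar> \<le> 4 * real n * sqrt (real n)"
        using T disc by blast
      also have "(\<Sum>u\<in>part i. \<Sum>v\<in>T - {u}. (of_bool (adj u v) - p u v)) =
          (\<Sum>u\<in>part i. deg u - ((L - 1) / 2 + drift i - bias i i))"
        by (intro sum.cong inner) auto
      also have "\<dots> = (\<Sum>u\<in>part i. deg u) - t i * ((L - 1) / 2 + drift i - bias i i)"
        by (simp add: sum_subtractf t_def)
      also have "4 * real n * sqrt (real n) = L / (6 * real m * 4 ^ m) * e"
        using \<open>L > 0\<close> \<open>m > 0\<close> by (simp add: e_def)
      also have "\<dots> \<le> t i * e"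
        using ti \<open>L > 0\<close> by (intro mult_right_mono) (auto simp: e_def)
      finally show ?thesis .
    qed
    have part: "finite (part i)" "part i \<noteq> {}" "part i \<subseteq> T"
      if "t i \<ge> L / (6 * real m * 4 ^ m)" for i
    proof -
      have "t i > 0" using that \<open>L > 0\<close> \<open>m > 0\<close> by (meson divide_pos_pos less_le_trans mult_pos_pos of_nat_0_less_iff zero_less_numeral zero_less_power)
      then show "part i \<noteq> {}" by (auto simp: t_def)
      show "part i \<subseteq> T" by (auto simp: part_def)
      then show "finite (part i)" using \<open>finite T\<close> finite_subset by blast
    qed
    have t_nonneg: "t j \<ge> 0" for j by (simp add: t_def)
    have bias_le: "\<bar>bias i i\<bar> \<le> 1" for i using abs_bias_le[of i i] by linarith
    obtain i where i: "t i \<ge> L / (6 * real m * 4 ^ m)" "drift i \<le> - (L / (6 * real m * 64 ^ m))"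
      using exists_negative_drift[OF \<open>m > 0\<close> t_nonneg t_sum] by (auto simp: drift_def)
    have "(\<Sum>u\<in>part i. deg u) \<le> t i * ((L - 1) / 2 + drift i - bias i i) + t i * e"
      using deg_sum[OF i(1)] by linarith
    also have "\<dots> = t i * ((L - 1) / 2 + drift i - bias i i + e)" by (simp add: algebra_simps)
    also have "\<dots> \<le> t i * ((L - 1) / 2 - g)"
      using i(2) bias_le[of i] t_nonneg[of i] by (intro mult_left_mono) (auto simp: g degree_gap_def e_def)
    finally obtain u where u: "u \<in> part i" "deg u \<le> (L - 1) / 2 - g"
      using exists_le_average[of "part i" deg] part[OF i(1)] by (auto simp: t_def)
    obtain j where j: "t j \<ge> L / (6 * real m * 4 ^ m)" "drift j \<ge> L / (6 * real m * 64 ^ m)"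
      using exists_positive_drift[OF \<open>m > 0\<close> t_nonneg t_sum \<open>L > 0\<close> t_le] by (auto simp: drift_def)
    have "(\<Sum>u\<in>part j. L - 1 - deg u) = t j * (L - 1) - (\<Sum>u\<in>part j. deg u)"
      by (simp add: sum_subtractf t_def)
    also have "\<dots> \<le> t j * (L - 1) - (t j * ((L - 1) / 2 + drift j - bias j j) - t j * e)"
      using deg_sum[OF j(1)] by linarith
    also have "\<dots> = t j * ((L - 1) / 2 - drift j + bias j j + e)"
      by (simp add: field_simps)
    also have "\<dots> \<le> t j * ((L - 1) / 2 - g)"
      using j(2) bias_le[of j] t_nonneg[of j] by (intro mult_left_mono) (auto simp: g degree_gap_def e_def)
    finally obtain w where w: "w \<in> part j" "L - 1 - deg w \<le> (L - 1) / 2 - g"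
      using exists_le_average[of "part j" "\<lambda>u. L - 1 - deg u"] part[OF j(1)] by (auto simp: t_def)
    have "u \<in> T" "w \<in> T" using u w part(3) i(1) j(1) by blast+
    moreover have "real (card {v \<in> T - {w}. \<not> adj w v}) \<le> (L - 1) / 2 - g"
      using w(2) codeg[OF \<open>w \<in> T\<close>] by simp
    ultimately show ?thesis using u(2) unfolding deg_def by blast
  qed
  then show thesis using that[of adj] sym by blast
qed

section \<open>Choice of the parameters\<close>

text \<open>
  This is the inequality needed for \<open>m = ln x\<close> and \<open>64 ^ m = x powr (\<nu> / 2)\<close> (crudely also used as a
  bound for \<open>4 ^ m\<close>), \<open>n = x ln x\<close> and \<open>L = x\<close>, after division by \<open>L\<close>. Up to logarithms the drift is
  \<open>x powr (- \<nu> / 2)\<close> and the discrepancy is \<open>x powr (\<nu> / 2 - 1 / 2)\<close>, which is smaller as \<open>\<nu> < 1 / 2\<close>.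
\<close>
lemma eventually_scales_dominate:
  fixes \<nu> :: real
  assumes "0 < \<nu>" "\<nu> \<le> 1 / 4"
  shows "\<forall>\<^sub>F x :: real in at_top. x powr (- \<nu>) <
    1 / (6 * ln x * x powr (\<nu> / 2)) - 1 / x -
    24 * ln x * x powr (\<nu> / 2) * (x * ln x) * sqrt (x * ln x) / x\<^sup>2"
proof -
  have "\<forall>\<^sub>F x :: real in at_top. ln x < 1 / 24 * x powr (\<nu> / 2)"
    using assms by real_asymp
  moreover have "\<forall>\<^sub>F x :: real in at_top. 24 * ln x * (x * ln x) * sqrt (x * ln x) * (24 * ln x) < x powr (7 / 4)"
    by real_asymp
  moreover have "\<forall>\<^sub>F x :: real in at_top. 24 * ln x < x powr (1 / 4)"
    by real_asymp
  ultimately show ?thesis using eventually_gt_at_top[of "exp 1"]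
  proof eventually_elim
    case (elim x)
    have "1 < exp (1::real)" by simp
    then have "x > 1" using elim by linarith
    then have "ln x > 0" by simp
    define a where "a = x powr (\<nu> / 2)"
    have "a > 0" using \<open>x > 1\<close> by (simp add: a_def)
    have "a * a = x powr \<nu>" by (simp add: a_def flip: powr_add)
    also have "\<dots> \<le> x powr (1 / 4)" using assms \<open>x > 1\<close> by simp
    finally have aa: "a * a \<le> x powr (1 / 4)" .
    have a: "a \<le> x powr (1 / 4)" using assms \<open>x > 1\<close> by (simp add: a_def)
    \<comment> \<open>A quarter of the drift term: each of the three other terms stays below it.\<close>
    define q where "q = 1 / (24 * ln x * a)"
    have 1: "x powr (- \<nu>) < q"
    proof -
      have "x powr (- \<nu>) = 1 / (a * a)"
        using \<open>a * a = x powr \<nu>\<close> by (simp add: powr_minus inverse_eq_divide)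
      also have "\<dots> < q"
        using elim(1) \<open>a > 0\<close> \<open>ln x > 0\<close> unfolding q_def a_def[symmetric]
        by (intro divide_strict_left_mono mult_strict_right_mono) auto
      finally show ?thesis .
    qed
    have 2: "1 / x < q"
    proof -
      have "24 * ln x * a < x powr (1 / 4) * x powr (1 / 4)"
        using elim(3) a \<open>a > 0\<close> by (intro mult_less_le_imp_less) (use \<open>ln x > 0\<close> in auto)
      also have "\<dots> = x powr (1 / 2)" by (simp flip: powr_add)
      also have "\<dots> \<le> x powr 1" using \<open>x > 1\<close> by (intro powr_mono) auto
      finally show ?thesis using \<open>a > 0\<close> \<open>ln x > 0\<close> \<open>x > 1\<close>
        unfolding q_def by (intro divide_strict_left_mono) auto
    qed
    have 3: "24 * ln x * a * (x * ln x) * sqrt (x * ln x) / x\<^sup>2 < q"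
    proof -
      have "24 * ln x * a * (x * ln x) * sqrt (x * ln x) * (24 * ln x * a) =
          24 * ln x * (x * ln x) * sqrt (x * ln x) * (24 * ln x) * (a * a)"
        by (simp add: mult_ac)
      also have "\<dots> < x powr (7 / 4) * x powr (1 / 4)"
        using elim(2) aa \<open>a > 0\<close> \<open>ln x > 0\<close> \<open>x > 1\<close> by (intro mult_less_le_imp_less) auto
      also have "\<dots> = x powr 2" by (simp flip: powr_add)
      also have "\<dots> = x\<^sup>2" using \<open>x > 1\<close> by simp
      finally show ?thesis using \<open>a > 0\<close> \<open>ln x > 0\<close> \<open>x > 1\<close> by (simp add: q_def field_simps)
    qed
    have "1 / (6 * ln x * a) = 4 * q" by (simp add: q_def)
    moreover have "q > 0" using \<open>a > 0\<close> \<open>ln x > 0\<close> by (simp add: q_def)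
    ultimately show ?case using 1 2 3 unfolding a_def[symmetric] by linarith
  qed
qed

text \<open>
  Divided by \<open>L\<close>, the left-hand side and all losses in the gap decrease in \<open>L\<close> while the drift stays
  constant, so \<open>L = k\<close> is the worst case and \<open>eventually_scales_dominate\<close> applies.
\<close>
lemma eventually_degree_gap_gt:
  fixes \<nu> :: real
  assumes "0 < \<nu>" "\<nu> \<le> 1 / 4"
  shows "\<forall>\<^sub>F k :: nat in sequentially. \<forall>m n L. 0 < m \<and> 64 ^ m \<le> real k powr (\<nu> / 2) \<and>
    n \<le> m * k \<and> real k \<le> L \<longrightarrow> L powr (- \<nu>) * L < degree_gap m n L"
proof -
  have "\<forall>\<^sub>F k :: nat in sequentially. real k powr (- \<nu>) <
    1 / (6 * ln (real k) * real k powr (\<nu> / 2)) - 1 / real k -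
    24 * ln (real k) * real k powr (\<nu> / 2) * (real k * ln (real k)) * sqrt (real k * ln (real k)) / (real k)\<^sup>2"
    using eventually_scales_dominate[OF assms] filterlim_real_sequentially
    by (rule eventually_compose_filterlim)
  then show ?thesis using eventually_gt_at_top[of 1]
  proof eventually_elim
    case (elim k)
    show ?case
    proof safe
      fix m n L assume m: "0 < m" "64 ^ m \<le> real k powr (\<nu> / 2)" and n: "n \<le> m * k" and L: "real k \<le> L"
      define x where "x = real k"
      have "x > 1" using elim by (simp add: x_def)
      have "L > 0" using L \<open>x > 1\<close> by (simp add: x_def)
      have "real m * 1 \<le> real m * ln 64"
        using ln_ge_iff[of 64 1] exp_le by (intro mult_left_mono) auto
      also have "\<dots> = ln (64 ^ m)" by (simp add: ln_realpow)
      also have "\<dots> \<le> ln (x powr (\<nu> / 2))" using m(2) by (intro ln_mono) (auto simp: x_def)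
      also have "\<dots> = \<nu> / 2 * ln x" using \<open>x > 1\<close> by (simp add: ln_powr)
      also have "\<dots> \<le> 1 * ln x" using assms \<open>x > 1\<close> by (intro mult_right_mono) auto
      finally have m_le: "real m \<le> ln x" by simp
      have "real n \<le> real m * x" using n by (metis of_nat_le_iff of_nat_mult x_def)
      also have "\<dots> \<le> x * ln x" using m_le \<open>x > 1\<close> by (simp add: mult.commute)
      finally have n_le: "real n \<le> x * ln x" .
      have "(4::real) ^ m \<le> 64 ^ m" by (intro power_mono) auto
      then have four: "4 ^ m \<le> x powr (\<nu> / 2)" using m(2) unfolding x_def by (rule order_trans)
      have "L powr (- \<nu>) \<le> x powr (- \<nu>)"
        using L \<open>x > 1\<close> assms by (intro powr_mono2') (auto simp: x_def)
      also have "\<dots> < 1 / (6 * ln x * x powr (\<nu> / 2)) - 1 / x -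
          24 * ln x * x powr (\<nu> / 2) * (x * ln x) * sqrt (x * ln x) / x\<^sup>2"
        using elim by (simp add: x_def)
      also have "\<dots> \<le> 1 / (6 * real m * 64 ^ m) - 1 / L -
          24 * real m * 4 ^ m * real n * sqrt (real n) / L\<^sup>2"
      proof (intro diff_mono)
        show "1 / (6 * ln x * x powr (\<nu> / 2)) \<le> 1 / (6 * real m * 64 ^ m)"
          using m m_le \<open>x > 1\<close>
          by (intro divide_left_mono mult_mono mult_pos_pos) (auto simp: x_def)
        show "1 / L \<le> 1 / x" using L \<open>x > 1\<close> by (intro divide_left_mono) (auto simp: x_def)
        show "24 * real m * 4 ^ m * real n * sqrt (real n) / L\<^sup>2 \<le>
          24 * ln x * x powr (\<nu> / 2) * (x * ln x) * sqrt (x * ln x) / x\<^sup>2"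
          using m_le n_le four L \<open>x > 1\<close>
          by (intro frac_le mult_mono power_mono) (auto simp: x_def)
      qed
      finally have "L powr (- \<nu>) * L < (1 / (6 * real m * 64 ^ m) - 1 / L -
          24 * real m * 4 ^ m * real n * sqrt (real n) / L\<^sup>2) * L"
        using \<open>L > 0\<close> by (intro mult_strict_right_mono)
      also have "\<dots> = degree_gap m n L"
        using \<open>L > 0\<close> by (simp add: degree_gap_def left_diff_distrib power2_eq_square)
      finally show "L powr (- \<nu>) * L < degree_gap m n L" .
    qed
  qed
qed

text \<open>
  The number of parts is the largest \<open>m\<close> with \<open>64 ^ m \<le> k powr (\<nu> / 2)\<close>. The factor \<open>16\<close> absorbs the two
  roundings: \<open>m\<close> is at least half of its unrounded value, and \<open>k div 3\<close> is at least \<open>k / 4\<close>.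
\<close>
lemma eventually_number_of_vertices:
  fixes \<nu> :: real
  assumes "0 < \<nu>"
  defines "m \<equiv> \<lambda>k :: nat. nat \<lfloor>\<nu> / (2 * ln 64) * ln (real k)\<rfloor>"
  shows "\<forall>\<^sub>F k :: nat in sequentially. 0 < m k \<and> 0 < k div 3 \<and>
    64 ^ m k \<le> real k powr (\<nu> / 2) \<and>
    \<nu> / (16 * ln 64) * real k * ln (real k) / ln (ln (real k)) \<le> real (m k * (k div 3))"
proof -
  have "\<forall>\<^sub>F k :: nat in sequentially. \<nu> / (2 * ln 64) * ln (real k) \<ge> 2"
  proof -
    have "\<forall>\<^sub>F k :: nat in sequentially. c * ln (real k) \<ge> 2" if "c > 0" for c :: real
      using that by real_asymp
    from this[of "\<nu> / (2 * ln 64)"] show ?thesis using \<open>0 < \<nu>\<close> by simp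
  qed
  moreover have "\<forall>\<^sub>F k :: nat in sequentially. ln (ln (real k)) \<ge> 1" by real_asymp
  moreover have "\<forall>\<^sub>F k :: nat in sequentially. k \<ge> 8" by (rule eventually_ge_at_top)
  ultimately show ?thesis
  proof eventually_elim
    case (elim k)
    define y where "y = \<nu> / (2 * ln 64) * ln (real k)"
    have "y \<ge> 2" using elim by (simp add: y_def)
    then have m: "real (m k) \<le> y" "y / 2 \<le> real (m k)" "0 < m k"
      unfolding m_def y_def[symmetric] by linarith+
    have k3: "real k / 4 \<le> real (k div 3)"
    proof -
      have "k \<le> 4 * (k div 3)" using elim(3) by presburger
      then have "real k \<le> real (4 * (k div 3))" by (simp only: of_nat_le_iff)
      then show ?thesis by simp
    qed
    have "64 ^ m k = exp (real (m k) * ln 64)" by (simp add: exp_of_nat_mult)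
    also have "\<dots> \<le> exp (y * ln 64)" using m by simp
    also have "\<dots> = real k powr (\<nu> / 2)" using elim(3) by (simp add: y_def powr_def)
    finally have pow: "64 ^ m k \<le> real k powr (\<nu> / 2)" .
    define z where "z = \<nu> / (16 * ln 64) * real k * ln (real k)"
    have "z \<ge> 0" using assms elim(3) by (simp add: z_def)
    then have "z / ln (ln (real k)) \<le> z / 1" using elim(2) by (intro divide_left_mono) auto
    also have "\<dots> = y / 2 * (real k / 4)" by (simp add: z_def y_def)
    also have "\<dots> \<le> real (m k) * real (k div 3)"
      using m k3 \<open>y \<ge> 2\<close> by (intro mult_mono) auto
    finally show ?case using pow m elim(3) by (simp add: z_def div_greater_zero_iff)
  qed
qed

section \<open>Induced subgraphs of the graph and its complement\<close>

lemma min_degree_induced_subgraph_le: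
  assumes "induced_subgraph H (with_proj G)" "finite (pverts G)" "u \<in> verts H"
  shows "min_degree H \<le> card {v \<in> verts H. (u, v) \<in> parcs G}"
proof -
  have H: "subgraph H (with_proj G)"
    "arcs H = {e \<in> parcs G. fst e \<in> verts H \<and> snd e \<in> verts H}"
    using assms(1) by (auto simp: induced_subgraph_def)
  then have sub: "verts H \<subseteq> pverts G" by (auto simp: subgraph_def)
  have "tail H = fst" using H(1) by (auto simp: subgraph_def compatible_def)
  have "out_arcs H u = Pair u ` {v \<in> verts H. (u, v) \<in> parcs G}"
    unfolding out_arcs_def H(2) \<open>tail H = fst\<close> using assms(3) by auto
  then have "out_degree H u = card {v \<in> verts H. (u, v) \<in> parcs G}"
    by (simp add: out_degree_def card_image inj_on_def)
  moreover have "min_degree H \<le> out_degree H u"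
    unfolding min_degree_def using assms finite_subset[OF sub] by (intro Min_le) auto
  ultimately show ?thesis by simp
qed
theorem theorem4:
  fixes \<nu> :: real
  assumes "\<nu> > 0"
  shows "\<exists>C>0. \<forall>\<^sub>F k :: nat in sequentially.
    \<exists>G :: nat pair_pre_digraph. pair_graph G \<and>
      real (card (pverts G)) \<ge> C * real k * ln (real k) / ln (ln (real k)) \<and>
      (\<forall>H. (induced_subgraph H (with_proj G) \<or>
             induced_subgraph H (with_proj (complement_graph G))) \<and>
            card (verts H) \<ge> k \<longrightarrow>
            real (min_degree H) <
              (1 / 2 - real (card (verts H)) powr (- \<nu>)) * (real (card (verts H)) - 1))"
proof -
  \<comment> \<open>A smaller exponent gives a stronger bound, and the discrepancy estimate needs a small one.\<close>
  define \<mu> where "\<mu> = min \<nu> (1 / 4)"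
  have \<mu>: "0 < \<mu>" "\<mu> \<le> 1 / 4" "\<mu> \<le> \<nu>" using assms by (auto simp: \<mu>_def)
  define m where "m k = nat \<lfloor>\<mu> / (2 * ln 64) * ln (real k)\<rfloor>" for k :: nat
  define C where "C = \<mu> / (16 * ln 64)"
  have "C > 0" using \<mu> by (simp add: C_def)
  moreover have "\<forall>\<^sub>F k :: nat in sequentially.
    \<exists>G :: nat pair_pre_digraph. pair_graph G \<and>
      real (card (pverts G)) \<ge> C * real k * ln (real k) / ln (ln (real k)) \<and>
      (\<forall>H. (induced_subgraph H (with_proj G) \<or>
             induced_subgraph H (with_proj (complement_graph G))) \<and>
            card (verts H) \<ge> k \<longrightarrow>
            real (min_degree H) <
              (1 / 2 - real (card (verts H)) powr (- \<nu>)) * (real (card (verts H)) - 1))"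
    using eventually_number_of_vertices[OF \<mu>(1)] eventually_degree_gap_gt[OF \<mu>(1,2)]
  proof eventually_elim
    case (elim k)
    define s n where "s = k div 3" and "n = m k * s"
    have m: "0 < m k" "0 < s" "64 ^ m k \<le> real k powr (\<mu> / 2)"
      and n_ge: "C * real k * ln (real k) / ln (ln (real k)) \<le> real n"
      using elim(1) by (auto simp: m_def s_def n_def C_def)
    have "n \<le> m k * k" by (simp add: n_def s_def)
    then have gap: "L powr (- \<mu>) * L < degree_gap (m k) n L" if "real k \<le> L" for L
      using elim(2) m that by blast
    obtain adj where adj_sym: "\<And>u v. adj u v = adj v u"
      and adj: "\<And>T. T \<subseteq> {..<n} \<Longrightarrow> 3 * s \<le> card T \<Longrightarrow>
        \<exists>u\<in>T. real (card {v \<in> T - {u}. adj u v})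
          \<le> (real (card T) - 1) / 2 - degree_gap (m k) n (real (card T))"
      and nonadj: "\<And>T. T \<subseteq> {..<n} \<Longrightarrow> 3 * s \<le> card T \<Longrightarrow>
        \<exists>u\<in>T. real (card {v \<in> T - {u}. \<not> adj u v})
          \<le> (real (card T) - 1) / 2 - degree_gap (m k) n (real (card T))"
      using exists_graph_without_balanced_subgraphs[OF m(1,2)] unfolding n_def by blast
    define G where "G = \<lparr> pverts = {..<n}, parcs = {(u, v). u < n \<and> v < n \<and> u \<noteq> v \<and> adj u v} \<rparr>"
    have "finite (parcs G)"
      by (rule finite_subset[of _ "{..<n} \<times> {..<n}"]) (auto simp: G_def)
    then have "pair_graph G"
      using adj_sym by unfold_locales (auto simp: G_def symmetric_def sym_def)
    moreover have "real (min_degree H) <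
        (1 / 2 - real (card (verts H)) powr (- \<nu>)) * (real (card (verts H)) - 1)"
      if H: "induced_subgraph H (with_proj G) \<or> induced_subgraph H (with_proj (complement_graph G))"
        and card_H: "card (verts H) \<ge> k" for H
    proof -
      define L where "L = real (card (verts H))"
      have "3 * s \<le> k" by (simp add: s_def)
      then have card_T: "3 * s \<le> card (verts H)" using card_H by linarith
      have "1 \<le> card (verts H)" using card_T \<open>0 < s\<close> by linarith
      then have "1 \<le> L" by (simp add: L_def)
      have T: "verts H \<subseteq> {..<n}"
        using H by (auto simp: induced_subgraph_def subgraph_def G_def complement_graph_def)
      have "real (min_degree H) \<le> (L - 1) / 2 - degree_gap (m k) n L"
        using H
      proof
        assume G: "induced_subgraph H (with_proj G)"
        obtain u where u: "u \<in> verts H" "real (card {v \<in> verts H - {u}. adj u v})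
            \<le> (L - 1) / 2 - degree_gap (m k) n L"
          using adj[OF T card_T] unfolding L_def by blast
        have "{v \<in> verts H. (u, v) \<in> parcs G} = {v \<in> verts H - {u}. adj u v}"
          using u T by (auto simp: G_def)
        moreover have "min_degree H \<le> card {v \<in> verts H. (u, v) \<in> parcs G}"
          using G u by (intro min_degree_induced_subgraph_le) (auto simp: G_def)
        ultimately show ?thesis using u(2) by simp
      next
        assume G: "induced_subgraph H (with_proj (complement_graph G))"
        obtain u where u: "u \<in> verts H" "real (card {v \<in> verts H - {u}. \<not> adj u v})
            \<le> (L - 1) / 2 - degree_gap (m k) n L"
          using nonadj[OF T card_T] unfolding L_def by blast
        have "{v \<in> verts H. (u, v) \<in> parcs (complement_graph G)} = {v \<in> verts H - {u}. \<not> adj u v}"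
          using u T by (auto simp: G_def complement_graph_def)
        moreover have "min_degree H \<le> card {v \<in> verts H. (u, v) \<in> parcs (complement_graph G)}"
          using G u by (intro min_degree_induced_subgraph_le) (auto simp: G_def complement_graph_def)
        ultimately show ?thesis using u(2) by simp
      qed
      also have "\<dots> < (L - 1) / 2 - L powr (- \<mu>) * L"
        using gap[of L] card_H by (simp add: L_def)
      also have "\<dots> \<le> (L - 1) / 2 - L powr (- \<nu>) * (L - 1)"
        using \<open>1 \<le> L\<close> \<mu>(3) by (intro diff_left_mono mult_mono powr_mono) auto
      also have "\<dots> = (1 / 2 - L powr (- \<nu>)) * (L - 1)" by (simp add: algebra_simps)
      finally show ?thesis by (simp add: L_def)
    qed
    moreover have "card (pverts G) = n" by (simp add: G_def)
    ultimately show ?case using n_ge by (intro exI[of _ G]) auto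
  qed
  ultimately show ?thesis by blast
qed

end
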